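(* Let $\mathcal{P}_0$ denote the one-dimensional subspace of $L^2[0,1]$ spanned by the scaling function $\phi(x)=\chi_{[0,1)}(x)$. For $j\ge 1$ define recursively $$\mathcal{A}_j=\left\{f_j\in L^2[0,1]:\ f_{j,k}\left(\frac{2k+1}{2^{j-1}}-x\right)=-f_{j,k}(x)\ \text{ for a.e. }x\in I_{j,k},\ k=0,1,\dots,2^{j-1}-1\right\},$$ where $f_{j,k}$ denotes the restriction of $f_j$ to $I_{j,k}$, and let $\mathcal{P}_j=\mathcal{P}_{j-1}\oplus\mathcal{A}_j$. Then: (i) $\mathcal{A}_j$ is the $j$-th wavelet subspace, spanned by the normalized Haar wavelets $\psi_{j-1,k}$, $k=0,1,\dots,2^{j-1}-1$; (ii) consequently, $\bigoplus_{j=1}^{\infty}\mathcal{A}_j$ is dense in $L^2[0,1]$. This construction reproduces the classical Haar wavelet decomposition and is naturally related to the Haar multiresolution analysis.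
   Context: $L^2[0,1]$ is the Hilbert space of square integrable complex-valued functions on the unit interval with inner product $\langle f,g\rangle=\int_0^1 f(x)\overline{g(x)}\,dx$. $\chi_{[0,1)}$ is the function equal to $1$ on $[0,1)$ and $0$ elsewhere. For $j\ge1$ and $k=0,1,\dots,2^{j-1}-1$, $I_{j,k}=\left[\frac{k}{2^{j-1}},\frac{k+1}{2^{j-1}}\right)$. The Haar mother wavelet is $\psi(x)=1$ for $0\le x<\frac12$, $\psi(x)=-1$ for $\frac12\le x<1$, and $\psi(x)=0$ otherwise. The normalized Haar wavelets are $\psi_{j,k}(x)=2^{j/2}\psi(2^jx-k)$ for $j\ge0$, $k=0,1,\dots,2^j-1$.
   Formalization: A_j is restricted to functions a.e. constant on dyadic intervals of length 2^{-j} (as displayed, sin(2πx) lies in A_1, so (i) fails); in (ii), density holds for P_0 plus the sum of the A_j, while the sum of the A_j alone has closure the orthogonal complement of P_0. *)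

theory Defs
  imports "HOL-Analysis.Analysis"
begin

(* Elements of L^2[0,1] are represented by functions real => complex; only their values on
   [0,1] matter, and equality in L^2[0,1] is equality almost everywhere on [0,1].
   The subspaces defined below are closed under almost everywhere equality, so that equality of
   the representing sets is equality of subspaces. *)

abbreviation unit_lebesgue :: "real measure" where
  "unit_lebesgue \<equiv> lebesgue_on {0..1}"

definition L2 :: "(real \<Rightarrow> complex) set" where
  "L2 = {f \<in> borel_measurable unit_lebesgue. integrable unit_lebesgue (\<lambda>x. (cmod (f x))\<^sup>2)}"

definition L2_inner :: "(real \<Rightarrow> complex) \<Rightarrow> (real \<Rightarrow> complex) \<Rightarrow> complex" where
  "L2_inner f g = (LINT x|unit_lebesgue. f x * cnj (g x))"

definition L2_norm :: "(real \<Rightarrow> complex) \<Rightarrow> real" where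
  "L2_norm f = sqrt (LINT x|unit_lebesgue. (cmod (f x))\<^sup>2)"

definition L2_span :: "(real \<Rightarrow> complex) set \<Rightarrow> (real \<Rightarrow> complex) set" where
  "L2_span B = {f \<in> L2. \<exists>F c. finite F \<and> F \<subseteq> B \<and>
     (AE x in unit_lebesgue. f x = (\<Sum>g\<in>F. c g * g x))}"

definition L2_closure :: "(real \<Rightarrow> complex) set \<Rightarrow> (real \<Rightarrow> complex) set" where
  "L2_closure S = {f \<in> L2. \<forall>e>0. \<exists>g\<in>S. L2_norm (\<lambda>x. f x - g x) < e}"

definition L2_orthocomp :: "(real \<Rightarrow> complex) set \<Rightarrow> (real \<Rightarrow> complex) set" where
  "L2_orthocomp S = {f \<in> L2. \<forall>g\<in>S. L2_inner f g = 0}"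

(* Algebraic sums of subspaces (finite sums in the case of a family, no completion). That such a
   sum is direct is a separate property, L2_independent. *)

definition L2_plus :: "(real \<Rightarrow> complex) set \<Rightarrow> (real \<Rightarrow> complex) set \<Rightarrow> (real \<Rightarrow> complex) set" where
  "L2_plus S T = {\<lambda>x. f x + g x |f g. f \<in> S \<and> g \<in> T}"

definition L2_Sum :: "nat set \<Rightarrow> (nat \<Rightarrow> (real \<Rightarrow> complex) set) \<Rightarrow> (real \<Rightarrow> complex) set" where
  "L2_Sum J S = {\<lambda>x. \<Sum>j\<in>F. a j x |F a. finite F \<and> F \<subseteq> J \<and> (\<forall>j\<in>F. a j \<in> S j)}"

definition L2_independent :: "nat set \<Rightarrow> (nat \<Rightarrow> (real \<Rightarrow> complex) set) \<Rightarrow> bool" where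
  "L2_independent J S \<longleftrightarrow> (\<forall>F a. finite F \<and> F \<subseteq> J \<and> (\<forall>j\<in>F. a j \<in> S j) \<and>
     (AE x in unit_lebesgue. (\<Sum>j\<in>F. a j x) = 0) \<longrightarrow>
       (\<forall>j\<in>F. AE x in unit_lebesgue. a j x = 0))"

definition dyadic_ivl :: "nat \<Rightarrow> nat \<Rightarrow> real set" where
  "dyadic_ivl j k = {real k / 2 ^ (j - 1) ..< (real k + 1) / 2 ^ (j - 1)}"

definition haar_scaling :: "real \<Rightarrow> complex" where
  "haar_scaling = indicator {0..<1}"

definition haar_mother :: "real \<Rightarrow> complex" where
  "haar_mother x = (if 0 \<le> x \<and> x < 1/2 then 1 else if 1/2 \<le> x \<and> x < 1 then - 1 else 0)"

definition haar_wavelet :: "nat \<Rightarrow> nat \<Rightarrow> real \<Rightarrow> complex" where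
  "haar_wavelet j k x = of_real (2 powr (real j / 2)) * haar_mother (2 ^ j * x - real k)"

(* The spaces V_0, V_1, ... of the Haar multiresolution analysis on [0,1]: functions constant on
   the dyadic intervals of length 2^(-j), which are those with first index j + 1. *)
definition haar_V :: "nat \<Rightarrow> (real \<Rightarrow> complex) set" where
  "haar_V j = {f \<in> L2. \<forall>k<2 ^ j. \<exists>c. AE x in lebesgue_on (dyadic_ivl (Suc j) k). f x = c}"

(* x \<mapsto> (2k+1)/2^(j-1) - x is the reflection about the midpoint of dyadic_ivl j k; j >= 1. *)
definition reflection_odd :: "nat \<Rightarrow> (real \<Rightarrow> complex) set" where
  "reflection_odd j = {f \<in> L2. \<forall>k<2 ^ (j - 1). AE x in lebesgue_on (dyadic_ivl j k).
     f ((2 * real k + 1) / 2 ^ (j - 1) - x) = - f x}"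

(* The j-th stage of the recursion takes place inside V_j. The reflection condition alone does not
   cut out a wavelet subspace: sin (2 pi x) lies in reflection_odd 1, which is infinite-dimensional,
   and sin (4 pi x) lies in both reflection_odd 1 and reflection_odd 2, so that the sum of these
   two spaces is not direct. *)
definition haar_A :: "nat \<Rightarrow> (real \<Rightarrow> complex) set" where
  "haar_A j = {f \<in> haar_V j. f \<in> reflection_odd j}"

primrec haar_P :: "nat \<Rightarrow> (real \<Rightarrow> complex) set" where
  "haar_P 0 = L2_span {haar_scaling}"
| "haar_P (Suc j) = L2_plus (haar_P j) (haar_A (Suc j))"

end

theory Submission
  imports Defs
begin

text \<open>
  Everything is measured against the indicators of the dyadic cells of generation \<open>n\<close>
  (\<open>dyadic_step n k\<close>), which form an orthogonal basis of \<open>haar_V n\<close>. Pairing a function with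
  them gives its conditional expectation \<open>dyadic_average n f\<close>, which is the orthogonal
  projection of \<open>f\<close> onto \<open>haar_V n\<close>.

  Three facts carry the proof. First, a function in \<open>haar_V (Suc n)\<close> takes two values on each
  cell of generation \<open>n\<close>, one on each half. Reflection in the midpoint exchanges the halves, so
  oddness says that the two values add up to \<open>0\<close>; but this sum is, up to a factor, the inner
  product with the indicator of the cell. Hence the reflection condition inside
  \<open>haar_V (Suc n)\<close> is orthogonality to \<open>haar_V n\<close> (\<open>haar_A_Suc\<close>). This gives the orthogonality
  of the spaces \<open>haar_A j\<close>, hence their independence, and the identity of \<open>haar_P\<close> with
  \<open>haar_V\<close>.

  Secondly, passing from the averages of generation \<open>n\<close> to those of generation \<open>Suc n\<close> adds
  exactly the wavelet terms of level \<open>n\<close>, at every point (\<open>dyadic_average_Suc\<close>). Therefore the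
  partial sums of the Haar expansion are the dyadic averages, and a function in
  \<open>haar_A (Suc n)\<close>, whose averages of generation \<open>n\<close> vanish, is the sum of its wavelet terms
  of level \<open>n\<close>.

  Thirdly, the spaces \<open>haar_V n\<close> together are dense in \<open>L2\<close> (\<open>haar_V_dense\<close>): a square integrable
  function is approximated by a bounded one, this by a continuous one, and this by its samples
  on a fine dyadic grid. Since \<open>dyadic_average n f\<close> is the best approximation of \<open>f\<close> in
  \<open>haar_V n\<close>, and these spaces increase, the averages converge to \<open>f\<close>; all statements about
  closures follow from this convergence.
\<close>

section \<open>Square integrable functions on the unit interval\<close>

lemma finite_measure_unit: "finite_measure unit_lebesgue"
  by (rule finite_measure_lebesgue_on) simp

lemma L2_measurable: "f \<in> L2 \<Longrightarrow> f \<in> borel_measurable unit_lebesgue"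
  by (simp add: L2_def)

lemma L2_square_integrable: "f \<in> L2 \<Longrightarrow> integrable unit_lebesgue (\<lambda>x. (cmod (f x))\<^sup>2)"
  by (simp add: L2_def)

lemma cmod_add_square_le: "(cmod (a + b))\<^sup>2 \<le> 2 * (cmod a)\<^sup>2 + 2 * (cmod b)\<^sup>2"
proof -
  have "(cmod (a + b))\<^sup>2 \<le> (cmod a + cmod b)\<^sup>2"
    by (intro power_mono norm_triangle_ineq) auto
  also have "\<dots> \<le> 2 * (cmod a)\<^sup>2 + 2 * (cmod b)\<^sup>2"
    using zero_le_power2[of "cmod a - cmod b"] by (simp add: power2_eq_square algebra_simps)
  finally show ?thesis .
qed

lemma L2_add:
  assumes f: "f \<in> L2" and g: "g \<in> L2"
  shows "(\<lambda>x. f x + g x) \<in> L2"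
proof -
  note [measurable] = L2_measurable[OF f] L2_measurable[OF g]
  have "integrable unit_lebesgue (\<lambda>x. (cmod (f x + g x))\<^sup>2)"
  proof (rule Bochner_Integration.integrable_bound)
    show "integrable unit_lebesgue (\<lambda>x. 2 * (cmod (f x))\<^sup>2 + 2 * (cmod (g x))\<^sup>2)"
      using L2_square_integrable[OF f] L2_square_integrable[OF g] by simp
  qed (auto simp: cmod_add_square_le)
  then show ?thesis by (simp add: L2_def)
qed

lemma L2_mult_const:
  assumes f: "f \<in> L2"
  shows "(\<lambda>x. c * f x) \<in> L2"
proof -
  note [measurable] = L2_measurable[OF f]
  show ?thesis
    using L2_square_integrable[OF f] by (simp add: L2_def norm_mult power_mult_distrib)
qed

lemma L2_diff: "f \<in> L2 \<Longrightarrow> g \<in> L2 \<Longrightarrow> (\<lambda>x. f x - g x) \<in> L2"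
  using L2_add[of f "\<lambda>x. (-1) * g x"] L2_mult_const[of g "-1"] by simp

lemma L2_bounded:
  assumes [measurable]: "f \<in> borel_measurable unit_lebesgue" and B: "\<And>x. x \<in> {0..1} \<Longrightarrow> cmod (f x) \<le> B"
  shows "f \<in> L2"
proof -
  interpret finite_measure unit_lebesgue by (rule finite_measure_unit)
  have "AE x in unit_lebesgue. norm ((cmod (f x))\<^sup>2) \<le> B\<^sup>2"
    by (rule AE_I2) (use B in \<open>auto intro!: power_mono\<close>)
  then show ?thesis
    unfolding L2_def by (auto intro!: integrable_const_bound)
qed

lemma L2_zero: "(\<lambda>x. 0) \<in> L2"
  by (rule L2_bounded[of _ 0]) auto

lemma L2_sum:
  "(\<And>i. i \<in> I \<Longrightarrow> f i \<in> L2) \<Longrightarrow> (\<lambda>x. \<Sum>i\<in>I. f i x) \<in> L2"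
  by (induction I rule: infinite_finite_induct) (auto intro: L2_add L2_zero)

text \<open>
  The product is dominated by the sum of the two squares.
\<close>
lemma L2_inner_integrable:
  assumes f: "f \<in> L2" and g: "g \<in> L2"
  shows "integrable unit_lebesgue (\<lambda>x. f x * cnj (g x))"
proof (rule Bochner_Integration.integrable_bound)
  note [measurable] = L2_measurable[OF f] L2_measurable[OF g]
  show "integrable unit_lebesgue (\<lambda>x. (cmod (f x))\<^sup>2 + (cmod (g x))\<^sup>2)"
    using L2_square_integrable[OF f] L2_square_integrable[OF g] by simp
  show "(\<lambda>x. f x * cnj (g x)) \<in> borel_measurable unit_lebesgue"
    by (intro borel_measurable_times borel_measurable_continuous_on[where f=cnj])
      (auto intro!: continuous_intros L2_measurable f g)
  have "a * b \<le> a\<^sup>2 + b\<^sup>2" for a b :: real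
    using zero_le_power2[of "a-b"] zero_le_power2[of a] zero_le_power2[of b]
    unfolding power2_diff by linarith
  then show "AE x in unit_lebesgue. norm (f x * cnj (g x)) \<le> norm ((cmod (f x))\<^sup>2 + (cmod (g x))\<^sup>2)"
    by (simp add: norm_mult)
qed

lemma L2_inner_add:
  "f \<in> L2 \<Longrightarrow> g \<in> L2 \<Longrightarrow> h \<in> L2 \<Longrightarrow> L2_inner (\<lambda>x. f x + g x) h = L2_inner f h + L2_inner g h"
  by (simp add: L2_inner_def ring_distribs L2_inner_integrable)

lemma L2_inner_diff:
  "f \<in> L2 \<Longrightarrow> g \<in> L2 \<Longrightarrow> h \<in> L2 \<Longrightarrow> L2_inner (\<lambda>x. f x - g x) h = L2_inner f h - L2_inner g h"
  by (simp add: L2_inner_def left_diff_distrib L2_inner_integrable)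

lemma L2_inner_mult: "L2_inner (\<lambda>x. c * f x) h = c * L2_inner f h"
  by (simp add: L2_inner_def mult.assoc)

lemma L2_inner_commute: "L2_inner g f = cnj (L2_inner f g)"
  unfolding L2_inner_def by (simp add: mult.commute flip: Bochner_Integration.integral_cnj)

lemma L2_inner_sum:
  assumes "\<And>i. i \<in> I \<Longrightarrow> f i \<in> L2" "h \<in> L2"
  shows "L2_inner (\<lambda>x. \<Sum>i\<in>I. f i x) h = (\<Sum>i\<in>I. L2_inner (f i) h)"
  unfolding L2_inner_def sum_distrib_right
  by (rule Bochner_Integration.integral_sum) (use assms in \<open>auto intro: L2_inner_integrable\<close>)

lemma L2_inner_cong_AE:
  assumes f: "f \<in> L2" and g: "g \<in> L2" and h: "h \<in> L2" and eq: "AE x in unit_lebesgue. f x = g x"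
  shows "L2_inner f h = L2_inner g h"
  unfolding L2_inner_def
  by (rule integral_cong_AE) (use eq L2_inner_integrable[OF f h] L2_inner_integrable[OF g h] in auto)

lemma L2_norm_square: "(L2_norm f)\<^sup>2 = (LINT x|unit_lebesgue. (cmod (f x))\<^sup>2)"
  unfolding L2_norm_def by (subst real_sqrt_pow2) (auto intro!: integral_nonneg_AE)

lemma L2_norm_nonneg: "L2_norm f \<ge> 0"
  unfolding L2_norm_def by (auto intro!: integral_nonneg_AE)

lemma L2_inner_self: "L2_inner f f = of_real ((L2_norm f)\<^sup>2)"
  unfolding L2_norm_square L2_inner_def
  by (simp add: complex_norm_square[symmetric] flip: of_real_power integral_complex_of_real)

lemma L2_norm_eq_0_AE:
  assumes f: "f \<in> L2" and "L2_norm f = 0"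
  shows "AE x in unit_lebesgue. f x = 0"
  using integral_nonneg_eq_0_iff_AE[OF L2_square_integrable[OF f]] assms(2)
  by (simp add: L2_norm_square[symmetric])

lemma L2_norm_pythagoras:
  assumes f: "f \<in> L2" and g: "g \<in> L2" and orth: "L2_inner f g = 0"
  shows "(L2_norm (\<lambda>x. f x + g x))\<^sup>2 = (L2_norm f)\<^sup>2 + (L2_norm g)\<^sup>2"
proof -
  let ?h = "\<lambda>x. f x + g x"
  have h: "?h \<in> L2" using f g by (rule L2_add)
  have orth': "L2_inner g f = 0" using orth L2_inner_commute[of g f] by simp
  have "L2_inner ?h ?h = L2_inner f ?h + L2_inner g ?h"
    using f g h by (rule L2_inner_add)
  also have "\<dots> = cnj (L2_inner ?h f) + cnj (L2_inner ?h g)"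
    by (simp only: L2_inner_commute[of f ?h] L2_inner_commute[of g ?h])
  also have "\<dots> = L2_inner f f + L2_inner g g"
    using f g by (simp add: L2_inner_add orth orth' flip: L2_inner_commute)
  finally have "complex_of_real ((L2_norm ?h)\<^sup>2) = of_real ((L2_norm f)\<^sup>2 + (L2_norm g)\<^sup>2)"
    by (simp add: L2_inner_self)
  then show ?thesis by (simp only: of_real_eq_iff)
qed

lemma L2_norm_add_square_le:
  assumes f: "f \<in> L2" and g: "g \<in> L2"
  shows "(L2_norm (\<lambda>x. f x + g x))\<^sup>2 \<le> 2 * (L2_norm f)\<^sup>2 + 2 * (L2_norm g)\<^sup>2"
proof -
  have "(L2_norm (\<lambda>x. f x + g x))\<^sup>2 \<le> (LINT x|unit_lebesgue. 2 * (cmod (f x))\<^sup>2 + 2 * (cmod (g x))\<^sup>2)"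
    unfolding L2_norm_square
    by (rule integral_mono)
      (use L2_square_integrable[OF L2_add[OF f g]] L2_square_integrable[OF f] L2_square_integrable[OF g]
        in \<open>auto simp: cmod_add_square_le\<close>)
  also have "\<dots> = 2 * (L2_norm f)\<^sup>2 + 2 * (L2_norm g)\<^sup>2"
    using L2_square_integrable[OF f] L2_square_integrable[OF g] by (simp add: L2_norm_square)
  finally show ?thesis .
qed

lemma L2_inner_zero [simp]: "L2_inner (\<lambda>x. 0) g = 0"
  by (simp add: L2_inner_def)

lemma L2_inner_add_right:
  "f \<in> L2 \<Longrightarrow> g \<in> L2 \<Longrightarrow> h \<in> L2 \<Longrightarrow> L2_inner h (\<lambda>x. f x + g x) = L2_inner h f + L2_inner h g"
  by (simp add: L2_inner_add L2_inner_commute[of h])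

lemma L2_inner_diff_right:
  "f \<in> L2 \<Longrightarrow> g \<in> L2 \<Longrightarrow> h \<in> L2 \<Longrightarrow> L2_inner h (\<lambda>x. f x - g x) = L2_inner h f - L2_inner h g"
  by (simp add: L2_inner_diff L2_inner_commute[of h])

lemma L2_inner_mult_right: "L2_inner h (\<lambda>x. c * f x) = cnj c * L2_inner h f"
  by (simp add: L2_inner_mult L2_inner_commute[of h])

lemma L2_inner_sum_right:
  assumes "\<And>i. i \<in> I \<Longrightarrow> f i \<in> L2" "h \<in> L2"
  shows "L2_inner h (\<lambda>x. \<Sum>i\<in>I. f i x) = (\<Sum>i\<in>I. L2_inner h (f i))"
  using assms by (simp add: L2_inner_sum L2_inner_commute[of h])

lemma L2_inner_cong_AE_right:
  assumes "f \<in> L2" "g \<in> L2" "h \<in> L2" "AE x in unit_lebesgue. f x = g x"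
  shows "L2_inner h f = L2_inner h g"
  using L2_inner_cong_AE[OF assms] by (simp add: L2_inner_commute[of h])

section \<open>Dyadic step functions\<close>

lemma in_dyadic_ivl_iff: "x \<in> dyadic_ivl (Suc n) k \<longleftrightarrow> real k \<le> 2 ^ n * x \<and> 2 ^ n * x < real k + 1"
  by (auto simp: dyadic_ivl_def field_simps)

lemma dyadic_ivl_subset:
  assumes "k < 2 ^ n"
  shows "dyadic_ivl (Suc n) k \<subseteq> {0..<1}"
proof
  fix x assume x: "x \<in> dyadic_ivl (Suc n) k"
  have "real k + 1 \<le> 2 ^ n" using assms
    by (metis Suc_leI of_nat_Suc of_nat_le_iff of_nat_numeral of_nat_power add.commute)
  then have "2 ^ n * x < 2 ^ n"
    using x unfolding in_dyadic_ivl_iff by linarith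
  then have "x < 1" by simp
  moreover have "0 \<le> real k / 2 ^ n" by simp
  then have "0 \<le> x" by (rule order_trans) (use x in \<open>simp add: dyadic_ivl_def\<close>)
  ultimately show "x \<in> {0..<1}" by simp
qed

lemma dyadic_ivl_unique:
  assumes "x \<in> dyadic_ivl (Suc n) k" "x \<in> dyadic_ivl (Suc n) l"
  shows "k = l"
  using assms unfolding in_dyadic_ivl_iff by linarith

lemma dyadic_ivl_cover:
  assumes "x \<in> {0..<1}"
  obtains k where "k < 2 ^ n" "x \<in> dyadic_ivl (Suc n) k"
proof
  let ?k = "nat \<lfloor>2 ^ n * x\<rfloor>"
  have nn: "0 \<le> 2 ^ n * x" using assms by auto
  have "2 ^ n * x < 2 ^ n" using assms by auto
  then have "\<lfloor>2 ^ n * x\<rfloor> < 2 ^ n"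
    by (simp add: floor_less_iff)
  then show "?k < 2 ^ n" using nn by (simp add: nat_less_iff)
  show "x \<in> dyadic_ivl (Suc n) ?k"
    unfolding in_dyadic_ivl_iff using nn by (simp; linarith)
qed

lemma dyadic_ivl_halves:
  "dyadic_ivl (Suc n) k = dyadic_ivl (Suc (Suc n)) (2 * k) \<union> dyadic_ivl (Suc (Suc n)) (2 * k + 1)"
  by (auto simp: in_dyadic_ivl_iff)

lemma dyadic_ivl_lebesgue [measurable, simp]: "dyadic_ivl n k \<in> sets lebesgue"
  by (simp add: dyadic_ivl_def)

lemma AE_lebesgue_on: "A \<in> sets lebesgue \<Longrightarrow> (AE x in lebesgue_on A. P x) \<longleftrightarrow> (AE x in lebesgue. x \<in> A \<longrightarrow> P x)"
  by (rule AE_restrict_space_iff) simp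

lemma AE_neq: "AE x in lebesgue. x \<noteq> (a::real)"
  by (rule AE_completion[OF AE_lborel_singleton])

text \<open>
  The cells of one generation cover the unit interval up to the endpoint \<open>1\<close>, a null set.
\<close>
lemma AE_unit_dyadic_iff:
  "(AE x in unit_lebesgue. P x) \<longleftrightarrow> (\<forall>k<2 ^ n. AE x in lebesgue_on (dyadic_ivl (Suc n) k). P x)"
proof
  assume *: "AE x in unit_lebesgue. P x"
  show "\<forall>k<2 ^ n. AE x in lebesgue_on (dyadic_ivl (Suc n) k). P x"
  proof (intro allI impI)
    fix k :: nat assume k: "k < 2 ^ n"
    from * have "AE x in lebesgue. x \<in> {0..1} \<longrightarrow> P x" by (simp add: AE_lebesgue_on)
    then have "AE x in lebesgue. x \<in> dyadic_ivl (Suc n) k \<longrightarrow> P x"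
      by eventually_elim (use dyadic_ivl_subset[OF k] in auto)
    then show "AE x in lebesgue_on (dyadic_ivl (Suc n) k). P x" by (simp add: AE_lebesgue_on)
  qed
next
  assume *: "\<forall>k<2 ^ n. AE x in lebesgue_on (dyadic_ivl (Suc n) k). P x"
  have "AE x in lebesgue. \<forall>k\<in>{..<2 ^ n}. x \<in> dyadic_ivl (Suc n) k \<longrightarrow> P x"
    by (rule AE_finite_allI) (use * in \<open>auto simp: AE_lebesgue_on\<close>)
  with AE_neq[of 1] have "AE x in lebesgue. x \<in> {0..1} \<longrightarrow> P x"
  proof eventually_elim
    case (elim x)
    show ?case
    proof
      assume "x \<in> {0..1}"
      with elim have "x \<in> {0..<1}" by auto
      then obtain k where "k < 2 ^ n" "x \<in> dyadic_ivl (Suc n) k" by (rule dyadic_ivl_cover)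
      with elim show "P x" by auto
    qed
  qed
  then show "AE x in unit_lebesgue. P x" by (simp add: AE_lebesgue_on)
qed

text \<open>
  The index of the cells is shifted so that those of generation \<open>n\<close> have length \<open>1 / 2 ^ n\<close>
  and \<open>haar_V n\<close> consists of the combinations of \<open>dyadic_step n k\<close> for \<open>k < 2 ^ n\<close>.
\<close>
definition dyadic_step :: "nat \<Rightarrow> nat \<Rightarrow> real \<Rightarrow> complex" where
  "dyadic_step n k = indicator (dyadic_ivl (Suc n) k)"

lemma dyadic_step_L2: "dyadic_step n k \<in> L2"
proof (rule L2_bounded)
  show "dyadic_step n k \<in> borel_measurable unit_lebesgue"
    unfolding dyadic_step_def
    by (rule measurable_restrict_space1) simp
qed (auto simp: dyadic_step_def indicator_def)

lemma dyadic_step_sum_at: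
  assumes "k < 2 ^ n" "x \<in> dyadic_ivl (Suc n) k"
  shows "(\<Sum>l<2 ^ n. c l * dyadic_step n l x) = c k"
proof -
  have "(\<Sum>l<2 ^ n. c l * dyadic_step n l x) = (\<Sum>l<2 ^ n. if l = k then c l else 0)"
  proof (rule sum.cong)
    fix l
    have "x \<in> dyadic_ivl (Suc n) l \<longleftrightarrow> l = k"
      using assms dyadic_ivl_unique by blast
    then show "c l * dyadic_step n l x = (if l = k then c l else 0)"
      using assms by (auto simp: dyadic_step_def)
  qed simp
  also have "\<dots> = c k" using assms by simp
  finally show ?thesis .
qed

text \<open>
  Distinct cells of one generation are disjoint, and each has length \<open>1 / 2 ^ n\<close>.
\<close>
lemma dyadic_step_inner:
  assumes "k < 2 ^ n"
  shows "L2_inner (dyadic_step n k) (dyadic_step n l) = (if k = l then 1 / 2 ^ n else 0)"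
proof -
  have "L2_inner (dyadic_step n k) (dyadic_step n l)
      = (LINT x|unit_lebesgue. complex_of_real (if k = l then indicator (dyadic_ivl (Suc n) k) x else 0))"
    unfolding L2_inner_def
    by (rule Bochner_Integration.integral_cong)
      (auto simp: dyadic_step_def indicator_def dest: dyadic_ivl_unique)
  also have "\<dots> = (if k = l then 1 / 2 ^ n else 0)"
  proof (cases "k = l")
    case True
    have sub: "dyadic_ivl (Suc n) k \<subseteq> {0..1}" using dyadic_ivl_subset[OF assms] by auto
    have "measure unit_lebesgue (dyadic_ivl (Suc n) k) = measure lebesgue (dyadic_ivl (Suc n) k)"
      by (rule measure_restrict_space) (use sub in auto)
    also have "\<dots> = 1 / 2 ^ n"
      by (simp add: dyadic_ivl_def field_simps)
    finally have "measure unit_lebesgue (dyadic_ivl (Suc n) k) = 1 / 2 ^ n" .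
    then show ?thesis using True sub by (simp add: Int_absorb2 integral_complex_of_real)
  qed simp
  finally show ?thesis .
qed

lemma dyadic_step_split:
  "dyadic_step n k x = dyadic_step (Suc n) (2 * k) x + dyadic_step (Suc n) (2 * k + 1) x"
proof -
  have "\<not> (x \<in> dyadic_ivl (Suc (Suc n)) (2 * k) \<and> x \<in> dyadic_ivl (Suc (Suc n)) (2 * k + 1))"
    using dyadic_ivl_unique[of x "Suc n" "2 * k" "2 * k + 1"] by auto
  then show ?thesis
    unfolding dyadic_step_def dyadic_ivl_halves[of n k] by (auto simp: indicator_def)
qed

lemma haar_scaling_eq_step: "haar_scaling = dyadic_step 0 0"
  by (auto simp: haar_scaling_def dyadic_step_def dyadic_ivl_def)

text \<open>
  A wavelet is the scaled difference of the two halves of a cell; with \<open>dyadic_step_split\<close>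
  this reduces all wavelet computations to those with indicators.
\<close>
lemma haar_wavelet_eq_steps:
  "haar_wavelet n k x = of_real (2 powr (real n / 2)) * (dyadic_step (Suc n) (2 * k) x - dyadic_step (Suc n) (2 * k + 1) x)"
  by (auto simp: haar_wavelet_def haar_mother_def dyadic_step_def in_dyadic_ivl_iff indicator_def)

lemma haar_V_iff:
  "f \<in> haar_V n \<longleftrightarrow> f \<in> L2 \<and> (\<exists>c. AE x in unit_lebesgue. f x = (\<Sum>k<2 ^ n. c k * dyadic_step n k x))"
proof -
  have *: "(AE x in lebesgue_on (dyadic_ivl (Suc n) k). f x = (\<Sum>k<2 ^ n. c k * dyadic_step n k x))
    \<longleftrightarrow> (AE x in lebesgue_on (dyadic_ivl (Suc n) k). f x = c k)" if "k < 2 ^ n" for k c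
    by (rule AE_cong) (simp add: dyadic_step_sum_at[OF that])
  have "(\<exists>c. AE x in unit_lebesgue. f x = (\<Sum>k<2 ^ n. c k * dyadic_step n k x))
    \<longleftrightarrow> (\<exists>c. \<forall>k<2 ^ n. AE x in lebesgue_on (dyadic_ivl (Suc n) k). f x = c k)"
    by (subst AE_unit_dyadic_iff[of _ n]) (simp add: * cong: conj_cong)
  also have "\<dots> \<longleftrightarrow> (\<forall>k<2 ^ n. \<exists>c. AE x in lebesgue_on (dyadic_ivl (Suc n) k). f x = c)"
    by metis
  finally show ?thesis unfolding haar_V_def by blast
qed

text \<open>
  The orthogonal projection onto \<open>haar_V n\<close>, equal on each cell to the mean of \<open>f\<close> over it:
  the factor \<open>2 ^ n\<close> is the inverse of the squared norm of the indicator.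
\<close>
definition dyadic_average :: "nat \<Rightarrow> (real \<Rightarrow> complex) \<Rightarrow> real \<Rightarrow> complex" where
  "dyadic_average n f x = (\<Sum>k<2 ^ n. 2 ^ n * L2_inner f (dyadic_step n k) * dyadic_step n k x)"

lemma dyadic_step_comb_L2: "(\<lambda>x. \<Sum>k\<in>K. c k * dyadic_step n k x) \<in> L2"
  by (intro L2_sum L2_mult_const dyadic_step_L2)

lemma dyadic_average_in_V: "dyadic_average n f \<in> haar_V n"
  unfolding haar_V_iff dyadic_average_def[abs_def] using dyadic_step_comb_L2
  by (auto intro!: exI[where x="\<lambda>k. 2 ^ n * L2_inner f (dyadic_step n k)"])

lemma dyadic_step_comb_inner:
  assumes "k < 2 ^ n"
  shows "L2_inner (\<lambda>x. \<Sum>l<2 ^ n. c l * dyadic_step n l x) (dyadic_step n k) = c k / 2 ^ n"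
proof -
  have "L2_inner (\<lambda>x. \<Sum>l<2 ^ n. c l * dyadic_step n l x) (dyadic_step n k)
     = (\<Sum>l<2 ^ n. L2_inner (\<lambda>x. c l * dyadic_step n l x) (dyadic_step n k))"
    by (rule L2_inner_sum) (auto intro: L2_mult_const dyadic_step_L2)
  also have "\<dots> = (\<Sum>l<2 ^ n. if l = k then c l / 2 ^ n else 0)"
    by (rule sum.cong) (auto simp: L2_inner_mult dyadic_step_inner)
  also have "\<dots> = c k / 2 ^ n" using assms by simp
  finally show ?thesis .
qed

lemma haar_V_imp_L2: "f \<in> haar_V n \<Longrightarrow> f \<in> L2"
  by (simp add: haar_V_def)

text \<open>
  The step coefficients of an element of \<open>haar_V n\<close> are its scaled inner products with the cells, so
  averaging reproduces it.
\<close>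
lemma dyadic_average_of_V:
  assumes "f \<in> haar_V n"
  shows "AE x in unit_lebesgue. f x = dyadic_average n f x"
proof -
  obtain c where f: "f \<in> L2" and c: "AE x in unit_lebesgue. f x = (\<Sum>k<2 ^ n. c k * dyadic_step n k x)"
    using assms unfolding haar_V_iff by blast
  have "L2_inner f (dyadic_step n k) = c k / 2 ^ n" if "k < 2 ^ n" for k
    using L2_inner_cong_AE[OF f dyadic_step_comb_L2 dyadic_step_L2 c] dyadic_step_comb_inner[OF that]
    by simp
  then have "dyadic_average n f x = (\<Sum>k<2 ^ n. c k * dyadic_step n k x)" for x
    unfolding dyadic_average_def by (intro sum.cong) auto
  then show ?thesis using c by simp
qed

lemma haar_V_add:
  assumes "f \<in> haar_V n" "g \<in> haar_V n"
  shows "(\<lambda>x. f x + g x) \<in> haar_V n"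
proof -
  obtain c where f: "f \<in> L2" and c: "AE x in unit_lebesgue. f x = (\<Sum>k<2 ^ n. c k * dyadic_step n k x)"
    using assms(1) unfolding haar_V_iff by blast
  obtain d where g: "g \<in> L2" and d: "AE x in unit_lebesgue. g x = (\<Sum>k<2 ^ n. d k * dyadic_step n k x)"
    using assms(2) unfolding haar_V_iff by blast
  have "AE x in unit_lebesgue. f x + g x = (\<Sum>k<2 ^ n. (c k + d k) * dyadic_step n k x)"
    using c d by eventually_elim (simp add: ring_distribs sum.distrib)
  then show ?thesis unfolding haar_V_iff using L2_add[OF f g]
    by (auto intro!: exI[where x="\<lambda>k. c k + d k"])
qed

lemma haar_V_mult:
  assumes "f \<in> haar_V n"
  shows "(\<lambda>x. a * f x) \<in> haar_V n"
proof -
  obtain c where f: "f \<in> L2" and c: "AE x in unit_lebesgue. f x = (\<Sum>k<2 ^ n. c k * dyadic_step n k x)"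
    using assms(1) unfolding haar_V_iff by blast
  have "AE x in unit_lebesgue. a * f x = (\<Sum>k<2 ^ n. (a * c k) * dyadic_step n k x)"
    using c by eventually_elim (simp add: sum_distrib_left mult.assoc)
  then show ?thesis unfolding haar_V_iff using L2_mult_const[OF f]
    by (auto intro!: exI[where x="\<lambda>k. a * c k"])
qed

lemma haar_V_diff: "f \<in> haar_V n \<Longrightarrow> g \<in> haar_V n \<Longrightarrow> (\<lambda>x. f x - g x) \<in> haar_V n"
  using haar_V_add[of f n "\<lambda>x. (-1) * g x"] haar_V_mult[of g n "-1"] by simp

lemma sum_lessThan_double: "(\<Sum>k<2 * m. f k) = (\<Sum>k<m. f (2 * k) + f (2 * k + 1))"
  for f :: "nat \<Rightarrow> 'a::comm_monoid_add"
  by (induction m) (simp_all add: add.assoc)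

lemma haar_V_Suc: "haar_V n \<subseteq> haar_V (Suc n)"
proof
  fix f assume "f \<in> haar_V n"
  then obtain c where f: "f \<in> L2" and c: "AE x in unit_lebesgue. f x = (\<Sum>k<2 ^ n. c k * dyadic_step n k x)"
    unfolding haar_V_iff by blast
  have "(\<Sum>k<2 ^ n. c k * dyadic_step n k x) = (\<Sum>k<2 ^ Suc n. c (k div 2) * dyadic_step (Suc n) k x)" for x
    unfolding power_Suc sum_lessThan_double
    by (simp add: dyadic_step_split[of n] ring_distribs)
  with f c show "f \<in> haar_V (Suc n)" unfolding haar_V_iff
    by (auto intro!: exI[where x="\<lambda>k. c (k div 2)"])
qed

lemma haar_V_mono: "m \<le> n \<Longrightarrow> haar_V m \<subseteq> haar_V n"
  by (rule lift_Suc_mono_le[of haar_V]) (use haar_V_Suc in auto)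

lemma L2_inner_haar_wavelet:
  assumes "f \<in> L2"
  shows "L2_inner f (haar_wavelet n k) = of_real (2 powr (real n / 2)) *
      (L2_inner f (dyadic_step (Suc n) (2 * k)) - L2_inner f (dyadic_step (Suc n) (2 * k + 1)))"
  unfolding haar_wavelet_eq_steps[abs_def]
  by (simp add: L2_inner_mult_right L2_inner_diff_right L2_diff dyadic_step_L2 assms)

text \<open>
  On the two halves of a cell let \<open>f\<close> have inner products \<open>a\<close>, \<open>b\<close> and let the indicators be
  \<open>u\<close>, \<open>v\<close>. Then the finer average is \<open>2 ^ Suc n * (a * u + b * v)\<close>, the coarser one is
  \<open>2 ^ n * (a + b) * (u + v)\<close>, and their difference \<open>2 ^ n * (a - b) * (u - v)\<close> is the wavelet term.
\<close>
lemma dyadic_average_Suc: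
  assumes "f \<in> L2"
  shows "dyadic_average (Suc n) f x =
     dyadic_average n f x + (\<Sum>k<2 ^ n. L2_inner f (haar_wavelet n k) * haar_wavelet n k x)"
proof -
  have inner: "L2_inner f (dyadic_step n k)
     = L2_inner f (dyadic_step (Suc n) (2 * k)) + L2_inner f (dyadic_step (Suc n) (2 * k + 1))" for k
    unfolding dyadic_step_split[of n k, abs_def]
    by (rule L2_inner_add_right) (intro dyadic_step_L2 assms)+
  \<comment> \<open>The normalisation enters twice, once in the coefficient and once in the wavelet.\<close>
  have sq: "complex_of_real (2 powr (real n / 2)) * complex_of_real (2 powr (real n / 2)) = 2 ^ n"
    by (simp flip: of_real_mult powr_add add: powr_realpow)
  have "L2_inner f (haar_wavelet n k) * haar_wavelet n k x =
    (complex_of_real (2 powr (real n / 2)) * complex_of_real (2 powr (real n / 2))) *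
      ((L2_inner f (dyadic_step (Suc n) (2 * k)) - L2_inner f (dyadic_step (Suc n) (2 * k + 1))) *
       (dyadic_step (Suc n) (2 * k) x - dyadic_step (Suc n) (2 * k + 1) x))" for k
    unfolding L2_inner_haar_wavelet[OF assms] haar_wavelet_eq_steps by (simp only: mult_ac)
  then have detail: "L2_inner f (haar_wavelet n k) * haar_wavelet n k x =
    2 ^ n * ((L2_inner f (dyadic_step (Suc n) (2 * k)) - L2_inner f (dyadic_step (Suc n) (2 * k + 1))) *
       (dyadic_step (Suc n) (2 * k) x - dyadic_step (Suc n) (2 * k + 1) x))" for k
    unfolding sq .
  have merge: "2 ^ Suc n * a * u + 2 ^ Suc n * b * v =
     2 ^ n * (a + b) * (u + v) + 2 ^ n * ((a - b) * (u - v))" for a b u v :: complex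
    by (simp add: algebra_simps)
  show ?thesis
    unfolding dyadic_average_def[of "Suc n"] power_Suc[where a="2::nat"] sum_lessThan_double
    unfolding dyadic_average_def[of n] sum.distrib[symmetric]
    unfolding detail inner dyadic_step_split[of n] by (rule sum.cong[OF refl merge])
qed

section \<open>The reflection condition as orthogonality\<close>

lemma dyadic_step_in_V:
  assumes "k < 2 ^ n"
  shows "dyadic_step n k \<in> haar_V n"
proof -
  have "(\<Sum>l<2 ^ n. (if l = k then 1 else 0) * dyadic_step n l x) = (\<Sum>l<2 ^ n. if l = k then dyadic_step n l x else 0)" for x
    by (rule sum.cong) auto
  then have "(\<Sum>l<2 ^ n. (if l = k then 1 else 0) * dyadic_step n l x) = dyadic_step n k x" for x
    using assms by simp
  then show ?thesis
    unfolding haar_V_iff using dyadic_step_L2[of n k]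
    by (auto intro!: exI[where x="\<lambda>l. if l = k then 1 else 0"])
qed

lemma orthocomp_haar_V_iff:
  "f \<in> L2_orthocomp (haar_V n) \<longleftrightarrow> f \<in> L2 \<and> (\<forall>k<2 ^ n. L2_inner f (dyadic_step n k) = 0)"
proof (intro iffI conjI allI impI)
  assume *: "f \<in> L2 \<and> (\<forall>k<2 ^ n. L2_inner f (dyadic_step n k) = 0)"
  have "L2_inner f g = 0" if V: "g \<in> haar_V n" for g
  proof -
    obtain c where g: "g \<in> L2" and c: "AE x in unit_lebesgue. g x = (\<Sum>k<2 ^ n. c k * dyadic_step n k x)"
      using V unfolding haar_V_iff by blast
    have "L2_inner f g = L2_inner f (\<lambda>x. \<Sum>k<2 ^ n. c k * dyadic_step n k x)"
      using * c g by (intro L2_inner_cong_AE_right dyadic_step_comb_L2) auto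
    also have "\<dots> = (\<Sum>k<2 ^ n. L2_inner f (\<lambda>x. c k * dyadic_step n k x))"
      using * by (intro L2_inner_sum_right L2_mult_const dyadic_step_L2) auto
    also have "\<dots> = 0" using * by (simp add: L2_inner_mult_right)
    finally show ?thesis .
  qed
  with * show "f \<in> L2_orthocomp (haar_V n)" by (simp add: L2_orthocomp_def)
qed (auto simp: L2_orthocomp_def dyadic_step_in_V)

lemma AE_reflect:
  fixes a :: real
  assumes "AE x in lebesgue. P x"
  shows "AE x in lebesgue. P (a - x)"
proof -
  obtain N where N: "negligible N" "{x. \<not> P x} \<subseteq> N"
    using assms by (auto simp: eventually_ae_filter_negligible)
  have "negligible ((\<lambda>x. a - x) ` N)"
    by (rule negligible_differentiable_image_negligible) (use N in \<open>auto intro!: derivative_intros\<close>)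
  moreover have "{x. \<not> P (a - x)} \<subseteq> (\<lambda>x. a - x) ` N"
  proof
    fix x assume "x \<in> {x. \<not> P (a - x)}"
    then have "a - x \<in> N" using N by auto
    then show "x \<in> (\<lambda>x. a - x) ` N" by (rule rev_image_eqI) simp
  qed
  ultimately show ?thesis by (auto simp: eventually_ae_filter_negligible)
qed

text \<open>
  A cell has positive measure, so a condition that does not depend on the point and holds almost
  everywhere on it holds.
\<close>
lemma AE_const_on_dyadic_ivl:
  assumes "AE x in lebesgue. x \<in> dyadic_ivl (Suc n) k \<longrightarrow> P"
  shows P
proof (rule ccontr)
  assume "\<not> P"
  with assms have "AE x in lebesgue. x \<notin> dyadic_ivl (Suc n) k" by simp
  then have "dyadic_ivl (Suc n) k \<in> null_sets lebesgue"
    by (subst AE_iff_null_sets) auto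
  then have "measure lebesgue (dyadic_ivl (Suc n) k) = 0"
    by (simp add: measure_eq_0_null_sets)
  moreover have "measure lebesgue (dyadic_ivl (Suc n) k) = 1 / 2 ^ n"
    by (simp add: dyadic_ivl_def field_simps)
  ultimately show False by simp
qed

text \<open>
  Reflection in the midpoint of a cell carries its left half to its right half and conversely, up
  to endpoints. So the reflected function takes the value of the other half almost everywhere,
  and oddness compares the two values on each cell.
\<close>
lemma reflection_odd_iff_coeffs:
  assumes f: "f \<in> L2"
    and d: "AE x in unit_lebesgue. f x = (\<Sum>k<2 ^ Suc n. d k * dyadic_step (Suc n) k x)"
  shows "f \<in> reflection_odd (Suc n) \<longleftrightarrow> (\<forall>k<2 ^ n. d (2 * k + 1) = - d (2 * k))"
proof -
  have val: "AE x in lebesgue. x \<in> dyadic_ivl (Suc (Suc n)) l \<longrightarrow> f x = d l" if l: "l < 2 ^ Suc n" for l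
  proof -
    have "AE x in lebesgue_on (dyadic_ivl (Suc (Suc n)) l). f x = (\<Sum>k<2 ^ Suc n. d k * dyadic_step (Suc n) k x)"
      using d l unfolding AE_unit_dyadic_iff[where n="Suc n"] by blast
    then have "AE x in lebesgue. x \<in> dyadic_ivl (Suc (Suc n)) l \<longrightarrow> f x = (\<Sum>k<2 ^ Suc n. d k * dyadic_step (Suc n) k x)"
      by (simp add: AE_lebesgue_on)
    then show ?thesis
      by eventually_elim (metis dyadic_step_sum_at[OF l])
  qed
  have "(AE x in lebesgue_on (dyadic_ivl (Suc n) k). f ((2 * real k + 1) / 2 ^ n - x) = - f x)
      \<longleftrightarrow> d (2 * k + 1) = - d (2 * k)" if k: "k < 2 ^ n" for k
  proof -
    let ?a = "(2 * real k + 1) / 2 ^ n"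
    let ?L = "dyadic_ivl (Suc (Suc n)) (2 * k)" and ?R = "dyadic_ivl (Suc (Suc n)) (2 * k + 1)"
    have L: "AE x in lebesgue. x \<in> ?L \<longrightarrow> f x = d (2 * k)" and R: "AE x in lebesgue. x \<in> ?R \<longrightarrow> f x = d (2 * k + 1)"
      using k by (auto intro!: val)
    \<comment> \<open>The halves are half-open, so the reflection matches them only away from the three endpoints.\<close>
    have swap: "x \<in> ?L \<longleftrightarrow> ?a - x \<in> ?R" "x \<in> ?R \<longleftrightarrow> ?a - x \<in> ?L"
      if "x \<noteq> real k / 2 ^ n" "x \<noteq> ?a / 2" "x \<noteq> (real k + 1) / 2 ^ n" for x
    proof -
      have "2 ^ n * x \<noteq> real k" "2 * (2 ^ n * x) \<noteq> 2 * real k + 1" "2 ^ n * x \<noteq> real k + 1"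
        "2 ^ n * (?a - x) = 2 * real k + 1 - 2 ^ n * x"
        using that by (auto simp: field_simps)
      then show "x \<in> ?L \<longleftrightarrow> ?a - x \<in> ?R" "x \<in> ?R \<longleftrightarrow> ?a - x \<in> ?L"
        unfolding in_dyadic_ivl_iff power_Suc mult.assoc by auto
    qed
    have "AE x in lebesgue. (x \<in> ?L \<longrightarrow> f x = d (2 * k) \<and> f (?a - x) = d (2 * k + 1)) \<and>
        (x \<in> ?R \<longrightarrow> f x = d (2 * k + 1) \<and> f (?a - x) = d (2 * k))"
      using L R AE_reflect[OF L, of ?a] AE_reflect[OF R, of ?a]
        AE_neq[of "real k / 2 ^ n"] AE_neq[of "?a / 2"] AE_neq[of "(real k + 1) / 2 ^ n"]
    proof eventually_elim
      case (elim x)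
      with swap[of x] show ?case by blast
    qed
    note fvals = this
    show ?thesis unfolding AE_lebesgue_on[OF dyadic_ivl_lebesgue]
    proof
      assume "AE x in lebesgue. x \<in> dyadic_ivl (Suc n) k \<longrightarrow> f (?a - x) = - f x"
      with fvals have "AE x in lebesgue. x \<in> ?L \<longrightarrow> d (2 * k + 1) = - d (2 * k)"
        by eventually_elim (auto simp: dyadic_ivl_halves[of n])
      then show "d (2 * k + 1) = - d (2 * k)" by (rule AE_const_on_dyadic_ivl)
    next
      assume anti: "d (2 * k + 1) = - d (2 * k)"
      from fvals show "AE x in lebesgue. x \<in> dyadic_ivl (Suc n) k \<longrightarrow> f (?a - x) = - f x"
      proof eventually_elim
        case (elim x)
        then show ?case unfolding dyadic_ivl_halves[of n] Un_iff using anti by force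
      qed
    qed
  qed
  then show ?thesis using f by (simp add: reflection_odd_def)
qed

text \<open>
  The inner product with the indicator of a cell of generation \<open>n\<close> is a multiple of the sum of
  the two values on its halves, so it vanishes exactly when these are opposite.
\<close>
lemma haar_A_Suc: "haar_A (Suc n) = haar_V (Suc n) \<inter> L2_orthocomp (haar_V n)"
proof -
  have "f \<in> reflection_odd (Suc n) \<longleftrightarrow> f \<in> L2_orthocomp (haar_V n)" if V: "f \<in> haar_V (Suc n)" for f
  proof -
    obtain d where f: "f \<in> L2" and d: "AE x in unit_lebesgue. f x = (\<Sum>k<2 ^ Suc n. d k * dyadic_step (Suc n) k x)"
      using V unfolding haar_V_iff by blast
    have fine: "L2_inner f (dyadic_step (Suc n) l) = d l / 2 ^ Suc n" if "l < 2 ^ Suc n" for l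
      using L2_inner_cong_AE[OF f dyadic_step_comb_L2 dyadic_step_L2 d] dyadic_step_comb_inner[OF that]
      by simp
    have "L2_inner f (dyadic_step n k) = 0 \<longleftrightarrow> d (2 * k + 1) = - d (2 * k)" if "k < 2 ^ n" for k
    proof -
      have "L2_inner f (dyadic_step n k)
         = L2_inner f (dyadic_step (Suc n) (2 * k)) + L2_inner f (dyadic_step (Suc n) (2 * k + 1))"
        unfolding dyadic_step_split[of n k, abs_def]
        by (rule L2_inner_add_right) (intro dyadic_step_L2 f)+
      also have "\<dots> = (d (2 * k) + d (2 * k + 1)) / 2 ^ Suc n"
        using that fine[of "2 * k"] fine[of "2 * k + 1"] by (simp add: add_divide_distrib)
      finally show ?thesis by (simp add: add_eq_0_iff)
    qed
    then show ?thesis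
      unfolding reflection_odd_iff_coeffs[OF f d] orthocomp_haar_V_iff using f by simp
  qed
  then show ?thesis unfolding haar_A_def by blast
qed

lemma haar_V_zero: "(\<lambda>x. 0) \<in> haar_V n"
  using haar_V_mult[OF dyadic_average_in_V, of 0] by simp

lemma haar_V_sum: "(\<And>i. i \<in> I \<Longrightarrow> f i \<in> haar_V n) \<Longrightarrow> (\<lambda>x. \<Sum>i\<in>I. f i x) \<in> haar_V n"
  by (induction I rule: infinite_finite_induct) (auto intro: haar_V_add haar_V_zero)

lemma haar_A_Suc_iff:
  "f \<in> haar_A (Suc n) \<longleftrightarrow> f \<in> haar_V (Suc n) \<and> (\<forall>k<2 ^ n. L2_inner f (dyadic_step n k) = 0)"
  unfolding haar_A_Suc Int_iff orthocomp_haar_V_iff using haar_V_imp_L2 by blast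

lemma haar_V_cong_AE:
  assumes f: "f \<in> L2" and g: "g \<in> haar_V n" and eq: "AE x in unit_lebesgue. f x = g x"
  shows "f \<in> haar_V n"
proof -
  obtain c where c: "AE x in unit_lebesgue. g x = (\<Sum>k<2 ^ n. c k * dyadic_step n k x)"
    using g unfolding haar_V_iff by blast
  from eq c have "AE x in unit_lebesgue. f x = (\<Sum>k<2 ^ n. c k * dyadic_step n k x)"
    by eventually_elim simp
  with f show ?thesis unfolding haar_V_iff by blast
qed

lemma haar_wavelet_in_A:
  assumes "k < 2 ^ n"
  shows "haar_wavelet n k \<in> haar_A (Suc n)"
proof -
  have V: "haar_wavelet n k \<in> haar_V (Suc n)"
    unfolding haar_wavelet_eq_steps[abs_def] using assms
    by (intro haar_V_mult haar_V_diff dyadic_step_in_V) auto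
  have "L2_inner (haar_wavelet n k) (dyadic_step n l) = 0" for l
  proof -
    have "L2_inner (dyadic_step (Suc n) i) (dyadic_step n l) = (if i div 2 = l then 1 / 2 ^ Suc n else 0)"
      if "i < 2 ^ Suc n" for i
      unfolding dyadic_step_split[of n l, abs_def]
      by (subst L2_inner_add_right) (use that in \<open>auto simp: dyadic_step_L2 dyadic_step_inner\<close>)
    then show ?thesis
      unfolding haar_wavelet_eq_steps[abs_def] using assms
      by (simp add: L2_inner_mult L2_inner_diff dyadic_step_L2)
  qed
  with V show ?thesis unfolding haar_A_Suc_iff by simp
qed

lemma haar_A_Suc_lincomb:
  assumes A: "\<And>i. i \<in> I \<Longrightarrow> f i \<in> haar_A (Suc n)"
  shows "(\<lambda>x. \<Sum>i\<in>I. c i * f i x) \<in> haar_A (Suc n)"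
proof -
  have V: "f i \<in> haar_V (Suc n)" and orth: "k < 2 ^ n \<Longrightarrow> L2_inner (f i) (dyadic_step n k) = 0"
    if "i \<in> I" for i k
    using A[OF that] by (auto simp: haar_A_Suc_iff)
  have "L2_inner (\<lambda>x. \<Sum>i\<in>I. c i * f i x) (dyadic_step n k) = 0" if k: "k < 2 ^ n" for k
  proof -
    have "L2_inner (\<lambda>x. \<Sum>i\<in>I. c i * f i x) (dyadic_step n k)
        = (\<Sum>i\<in>I. L2_inner (\<lambda>x. c i * f i x) (dyadic_step n k))"
      by (intro L2_inner_sum L2_mult_const dyadic_step_L2 haar_V_imp_L2[OF V])
    then show ?thesis using orth[OF _ k] by (simp add: L2_inner_mult)
  qed
  moreover have "(\<lambda>x. \<Sum>i\<in>I. c i * f i x) \<in> haar_V (Suc n)"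
    by (intro haar_V_sum haar_V_mult V)
  ultimately show ?thesis by (simp add: haar_A_Suc_iff)
qed

lemma haar_A_Suc_cong_AE:
  assumes f: "f \<in> L2" and g: "g \<in> haar_A (Suc n)" and eq: "AE x in unit_lebesgue. f x = g x"
  shows "f \<in> haar_A (Suc n)"
proof -
  have V: "g \<in> haar_V (Suc n)" using g by (simp add: haar_A_Suc_iff)
  show ?thesis
    using g haar_V_cong_AE[OF f V eq] L2_inner_cong_AE[OF f haar_V_imp_L2[OF V] dyadic_step_L2 eq]
    by (simp add: haar_A_Suc_iff)
qed

text \<open>
  Needed because the span is taken over a set of functions, while the expansion is a sum over
  \<open>k\<close>. The wavelet with index \<open>k\<close> is the only one of its level that does not vanish at the left
  endpoint of the cell \<open>k\<close>.
\<close>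
lemma inj_haar_wavelet: "inj (haar_wavelet n)"
proof (rule injI)
  fix k l assume eq: "haar_wavelet n k = haar_wavelet n l"
  have "haar_wavelet n l (real k / 2 ^ n) \<noteq> 0"
    unfolding eq[symmetric] by (simp add: haar_wavelet_def haar_mother_def)
  then have "\<bar>real k - real l\<bar> < 1"
    by (auto simp: haar_wavelet_def haar_mother_def split: if_splits)
  then show "k = l" by linarith
qed

text \<open>
  An element of \<open>haar_A (Suc n)\<close> equals its average of generation \<open>Suc n\<close>, while its average of
  generation \<open>n\<close> is zero by orthogonality; the difference of the two averages is the sum of
  the wavelet terms.
\<close>
lemma haar_A_Suc_eq_span: "haar_A (Suc n) = L2_span {haar_wavelet n k |k. k < 2 ^ n}"
proof (intro equalityI subsetI)
  fix f assume "f \<in> haar_A (Suc n)"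
  then have V: "f \<in> haar_V (Suc n)" and f: "f \<in> L2" and orth: "\<And>k. k < 2 ^ n \<Longrightarrow> L2_inner f (dyadic_step n k) = 0"
    unfolding haar_A_Suc_iff by (auto intro: haar_V_imp_L2)
  let ?F = "haar_wavelet n ` {..<2 ^ n}"
  have "dyadic_average n f x = 0" for x
    unfolding dyadic_average_def using orth by simp
  then have "dyadic_average (Suc n) f x = (\<Sum>g\<in>?F. L2_inner f g * g x)" for x
    by (simp add: dyadic_average_Suc[OF f] sum.reindex inj_on_subset[OF inj_haar_wavelet])
  then have "AE x in unit_lebesgue. f x = (\<Sum>g\<in>?F. L2_inner f g * g x)"
    using dyadic_average_of_V[OF V] by simp
  then show "f \<in> L2_span {haar_wavelet n k |k. k < 2 ^ n}"
    unfolding L2_span_def using f by (auto intro!: exI[where x="?F"] exI[where x="L2_inner f"])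
next
  fix f assume "f \<in> L2_span {haar_wavelet n k |k. k < 2 ^ n}"
  then obtain F c where f: "f \<in> L2" and F: "F \<subseteq> {haar_wavelet n k |k. k < 2 ^ n}"
    and c: "AE x in unit_lebesgue. f x = (\<Sum>g\<in>F. c g * g x)"
    unfolding L2_span_def by blast
  have "(\<lambda>x. \<Sum>g\<in>F. c g * g x) \<in> haar_A (Suc n)"
    by (rule haar_A_Suc_lincomb) (use F haar_wavelet_in_A in blast)
  with f c show "f \<in> haar_A (Suc n)" by (blast intro: haar_A_Suc_cong_AE)
qed

section \<open>Density of the dyadic step functions\<close>

lemma L2_norm_square_tendsto_0:
  assumes [measurable]: "\<And>n::nat. u n \<in> borel_measurable unit_lebesgue"
    and lim: "AE x in unit_lebesgue. (\<lambda>n. u n x) \<longlonglongrightarrow> 0"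
    and w: "integrable unit_lebesgue w" and bound: "\<And>n x. x \<in> {0..1} \<Longrightarrow> (cmod (u n x))\<^sup>2 \<le> w x"
  shows "(\<lambda>n. (L2_norm (u n))\<^sup>2) \<longlonglongrightarrow> 0"
proof -
  have "(\<lambda>n. LINT x|unit_lebesgue. (cmod (u n x))\<^sup>2) \<longlonglongrightarrow> (LINT x|unit_lebesgue. 0::real)"
  proof (rule integral_dominated_convergence)
    show "AE x in unit_lebesgue. (\<lambda>n. (cmod (u n x))\<^sup>2) \<longlonglongrightarrow> 0"
      using lim
    proof eventually_elim
      case (elim x)
      show ?case using tendsto_power[OF tendsto_norm[OF elim], of 2] by simp
    qed
    show "AE x in unit_lebesgue. norm ((cmod (u n x))\<^sup>2) \<le> w x" for n
      by (rule AE_I2) (use bound in simp)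
  qed (use w in auto)
  then show ?thesis by (simp add: L2_norm_square)
qed

text \<open>
  Radial truncation of the complex plane to the disc of radius \<open>M\<close>. As a nearest-point
  projection onto a closed convex set it is continuous.
\<close>
definition clip :: "real \<Rightarrow> complex \<Rightarrow> complex" where
  "clip M = closest_point (cball 0 M)"

lemma continuous_on_clip: "0 \<le> M \<Longrightarrow> continuous_on A (clip M)"
  unfolding clip_def by (rule continuous_on_closest_point) auto

lemma cmod_clip_le: "0 \<le> M \<Longrightarrow> cmod (clip M z) \<le> M"
  unfolding clip_def using closest_point_in_set[of "cball 0 M" z] by auto

lemma clip_self: "cmod z \<le> M \<Longrightarrow> clip M z = z"
  unfolding clip_def by (rule closest_point_self) simp

lemma cmod_diff_clip_le: "0 \<le> M \<Longrightarrow> cmod (z - clip M z) \<le> cmod z"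
  unfolding clip_def using closest_point_le[of "cball 0 M" 0 z] by (simp add: dist_norm)

lemma measurable_clip:
  assumes "f \<in> borel_measurable unit_lebesgue" "0 \<le> M"
  shows "(\<lambda>x. clip M (f x)) \<in> borel_measurable unit_lebesgue"
  by (rule borel_measurable_continuous_on[OF continuous_on_clip]) (use assms in auto)

lemma continuous_measurable_unit:
  "continuous_on UNIV g \<Longrightarrow> g \<in> borel_measurable unit_lebesgue"
  for g :: "real \<Rightarrow> complex"
  by (rule continuous_imp_measurable_on_sets_lebesgue[OF continuous_on_subset]) auto

text \<open>
  The truncation error tends to \<open>0\<close> pointwise and is dominated by \<open>f\<close> itself.
\<close>
lemma clip_dense:
  assumes f: "f \<in> L2" and e: "0 < e"
  obtains M where "0 \<le> M" "(L2_norm (\<lambda>x. f x - clip M (f x)))\<^sup>2 < e"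
proof -
  note [measurable] = L2_measurable[OF f]
  have "(\<lambda>n. (L2_norm (\<lambda>x. f x - clip (real n) (f x)))\<^sup>2) \<longlonglongrightarrow> 0"
  proof (rule L2_norm_square_tendsto_0)
    show "(\<lambda>x. f x - clip (real n) (f x)) \<in> borel_measurable unit_lebesgue" for n
      by (intro borel_measurable_diff measurable_clip) auto
    show "AE x in unit_lebesgue. (\<lambda>n. f x - clip (real n) (f x)) \<longlonglongrightarrow> 0"
    proof (rule AE_I2)
      fix x
      have "\<forall>\<^sub>F n in sequentially. cmod (f x) \<le> real n"
        by (rule eventually_compose_filterlim[OF eventually_ge_at_top filterlim_real_sequentially])
      then have "\<forall>\<^sub>F n in sequentially. f x - clip (real n) (f x) = 0"
        by eventually_elim (simp add: clip_self)
      then show "(\<lambda>n. f x - clip (real n) (f x)) \<longlonglongrightarrow> 0" by (rule tendsto_eventually)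
    qed
    show "integrable unit_lebesgue (\<lambda>x. (cmod (f x))\<^sup>2)" using f by (rule L2_square_integrable)
  qed (simp add: power_mono cmod_diff_clip_le)
  then have "\<forall>\<^sub>F n in sequentially. (L2_norm (\<lambda>x. f x - clip (real n) (f x)))\<^sup>2 < e"
    using e by (rule order_tendstoD(2))
  then obtain n where "(L2_norm (\<lambda>x. f x - clip (real n) (f x)))\<^sup>2 < e"
    by (auto simp: eventually_sequentially)
  then show ?thesis using that[of "real n"] by simp
qed

text \<open>
  A measurable function is an almost everywhere limit of continuous functions. Clipping these at
  the bound of \<open>f\<close> keeps them continuous and converging to \<open>f\<close>, and makes the convergence
  dominated.
\<close>
lemma continuous_approx_of_bounded:
  assumes [measurable]: "f \<in> borel_measurable unit_lebesgue" and M: "0 \<le> M"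
    and bound: "\<And>x. cmod (f x) \<le> M" and e: "0 < e"
  obtains g where "continuous_on UNIV g" "\<And>x. cmod (g x) \<le> M" "(L2_norm (\<lambda>x. f x - g x))\<^sup>2 < e"
proof -
  have "f measurable_on {0..1}"
    by (subst measurable_on_iff_borel_measurable) auto
  then obtain N h where N: "negligible N" and h: "\<And>n::nat. continuous_on UNIV (h n)"
    and lim: "\<And>x. x \<notin> N \<Longrightarrow> (\<lambda>n. h n x) \<longlonglongrightarrow> (if x \<in> {0..1} then f x else 0)"
    unfolding measurable_on_def by metis
  define g where "g n x = clip M (h n x)" for n x
  have g: "continuous_on UNIV (g n)" for n
    unfolding g_def by (rule continuous_on_compose2[OF continuous_on_clip[OF M] h]) auto
  have gM: "cmod (g n x) \<le> M" for n x
    unfolding g_def using M by (rule cmod_clip_le)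
  have "(\<lambda>n. (L2_norm (\<lambda>x. f x - g n x))\<^sup>2) \<longlonglongrightarrow> 0"
  proof (rule L2_norm_square_tendsto_0)
    show "(\<lambda>x. f x - g n x) \<in> borel_measurable unit_lebesgue" for n
      by (intro borel_measurable_diff continuous_measurable_unit[OF g]) simp
    have "AE x in lebesgue. x \<notin> N"
      unfolding eventually_ae_filter_negligible using N by blast
    then have "AE x in lebesgue. x \<in> {0..1} \<longrightarrow> (\<lambda>n. f x - g n x) \<longlonglongrightarrow> 0"
    proof eventually_elim
      case (elim x)
      show ?case
      proof
        assume "x \<in> {0..1}"
        with lim[OF elim] have "(\<lambda>n. h n x) \<longlonglongrightarrow> f x" by simp
        then have "(\<lambda>n. g n x) \<longlonglongrightarrow> clip M (f x)"
          unfolding g_def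
          by (rule continuous_on_tendsto_compose[OF continuous_on_clip[OF M, of UNIV]]) auto
        then have "(\<lambda>n. g n x) \<longlonglongrightarrow> f x" by (simp add: clip_self bound)
        then show "(\<lambda>n. f x - g n x) \<longlonglongrightarrow> 0"
          using tendsto_diff[OF tendsto_const[of "f x"]] by fastforce
      qed
    qed
    then show "AE x in unit_lebesgue. (\<lambda>n. f x - g n x) \<longlonglongrightarrow> 0"
      by (simp add: AE_lebesgue_on)
    show "integrable unit_lebesgue (\<lambda>x. (2 * M)\<^sup>2)"
      by (rule finite_measure.integrable_const[OF finite_measure_unit])
    show "(cmod (f x - g n x))\<^sup>2 \<le> (2 * M)\<^sup>2" for n x
      using norm_triangle_ineq4[of "f x" "g n x"] bound[of x] gM[of n x]
      by (intro power_mono) auto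
  qed
  then have "\<forall>\<^sub>F n in sequentially. (L2_norm (\<lambda>x. f x - g n x))\<^sup>2 < e"
    using e by (rule order_tendstoD(2))
  then obtain n where "(L2_norm (\<lambda>x. f x - g n x))\<^sup>2 < e"
    by (auto simp: eventually_sequentially)
  then show ?thesis using that[of "g n"] g gM by simp
qed

lemma L2_norm_square_le_of_bound:
  assumes f: "f \<in> L2" and "AE x in unit_lebesgue. cmod (f x) \<le> d"
  shows "(L2_norm f)\<^sup>2 \<le> d\<^sup>2"
proof -
  have "(L2_norm f)\<^sup>2 \<le> (LINT x|unit_lebesgue. d\<^sup>2)"
    unfolding L2_norm_square
  proof (rule integral_mono_AE)
    show "integrable unit_lebesgue (\<lambda>x. d\<^sup>2)"
      by (rule finite_measure.integrable_const[OF finite_measure_unit])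
    show "AE x in unit_lebesgue. (cmod (f x))\<^sup>2 \<le> d\<^sup>2"
      using assms(2) by eventually_elim (simp add: power_mono)
  qed (use L2_square_integrable[OF f] in auto)
  also have "\<dots> = d\<^sup>2" by (simp add: measure_restrict_space)
  finally show ?thesis .
qed

lemma continuous_L2:
  assumes "continuous_on UNIV g" "\<And>x. cmod (g x) \<le> M"
  shows "g \<in> L2"
  using continuous_measurable_unit[OF assms(1)] by (rule L2_bounded) (rule assms(2))

text \<open>
  By uniform continuity, sampling \<open>g\<close> at the left endpoints of sufficiently fine cells gives a
  uniform approximation.
\<close>
lemma step_approx_of_continuous:
  assumes g: "continuous_on UNIV g" "\<And>x. cmod (g x) \<le> M" and e: "0 < e"
  obtains n s where "s \<in> haar_V n" "(L2_norm (\<lambda>x. g x - s x))\<^sup>2 < e"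
proof -
  define d where "d = sqrt (e / 2)"
  have d: "0 < d" "d\<^sup>2 < e" using e by (simp_all add: d_def)
  have "uniformly_continuous_on {0..1} g"
    using g(1) by (intro compact_uniformly_continuous continuous_on_subset[OF g(1)]) auto
  then obtain r where r: "0 < r" and unif: "\<And>x y. x \<in> {0..1} \<Longrightarrow> y \<in> {0..1} \<Longrightarrow> dist y x < r \<Longrightarrow> dist (g y) (g x) < d"
    using d(1) unfolding uniformly_continuous_on_def by metis
  obtain n where n: "(1/2) ^ n < r"
    using real_arch_pow_inv[OF r, of "1/2"] by auto
  define s where "s x = (\<Sum>k<2 ^ n. g (real k / 2 ^ n) * dyadic_step n k x)" for x
  have sV: "s \<in> haar_V n"
    unfolding haar_V_iff s_def[abs_def] using dyadic_step_comb_L2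
    by (auto intro!: exI[where x="\<lambda>k. g (real k / 2 ^ n)"])
  have "cmod (g x - s x) \<le> d" if x: "x \<in> {0..<1}" for x
  proof -
    obtain k where k: "k < 2 ^ n" "x \<in> dyadic_ivl (Suc n) k" using x by (rule dyadic_ivl_cover)
    have s: "s x = g (real k / 2 ^ n)" unfolding s_def by (rule dyadic_step_sum_at[OF k])
    have x': "real k / 2 ^ n \<le> x" "x < real k / 2 ^ n + (1/2) ^ n"
      using k(2) by (auto simp: dyadic_ivl_def add_divide_distrib power_one_over)
    have "0 \<le> real k / 2 ^ n" by simp
    then have "dist (g x) (g (real k / 2 ^ n)) < d"
      using x x' n k(1) by (intro unif) (auto simp: dist_real_def)
    then show ?thesis by (simp add: s dist_norm)
  qed
  moreover have "AE x in unit_lebesgue. x \<in> {0..<1}"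
    unfolding AE_lebesgue_on[of "{0..1::real}", simplified] using AE_neq[of 1] by eventually_elim auto
  ultimately have "AE x in unit_lebesgue. cmod (g x - s x) \<le> d"
    by (auto elim: eventually_mono)
  then have "(L2_norm (\<lambda>x. g x - s x))\<^sup>2 \<le> d\<^sup>2"
    by (intro L2_norm_square_le_of_bound L2_diff continuous_L2[OF g] haar_V_imp_L2[OF sV])
  with d(2) have "(L2_norm (\<lambda>x. g x - s x))\<^sup>2 < e" by simp
  with sV show ?thesis by (rule that)
qed

text \<open>
  The three approximations are chained by the inequality
  \<open>(L2_norm (u + v))\<^sup>2 \<le> 2 * (L2_norm u)\<^sup>2 + 2 * (L2_norm v)\<^sup>2\<close>, whence the tolerances
  \<open>e / 16\<close>, \<open>e / 16\<close> and \<open>e / 8\<close>.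
\<close>
lemma haar_V_dense:
  assumes f: "f \<in> L2" and e: "0 < e"
  obtains n s where "s \<in> haar_V n" "(L2_norm (\<lambda>x. f x - s x))\<^sup>2 < e"
proof -
  obtain M where M: "0 \<le> M" and 1: "(L2_norm (\<lambda>x. f x - clip M (f x)))\<^sup>2 < e / 16"
    using clip_dense[OF f, of "e / 16"] e by auto
  let ?h = "\<lambda>x. clip M (f x)"
  have hm: "?h \<in> borel_measurable unit_lebesgue"
    using L2_measurable[OF f] M by (rule measurable_clip)
  have h: "?h \<in> L2" using hm by (rule L2_bounded) (use M cmod_clip_le in blast)
  obtain g where g: "continuous_on UNIV g" "\<And>x. cmod (g x) \<le> M" and 2: "(L2_norm (\<lambda>x. ?h x - g x))\<^sup>2 < e / 16"
    using continuous_approx_of_bounded[OF hm M cmod_clip_le[OF M], of "e / 16"] e by auto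
  have gL: "g \<in> L2" using g by (rule continuous_L2)
  obtain n s where s: "s \<in> haar_V n" and 3: "(L2_norm (\<lambda>x. g x - s x))\<^sup>2 < e / 8"
    by (rule step_approx_of_continuous[OF g, of "e / 8"]) (use e in simp)
  have sL: "s \<in> L2" using s by (rule haar_V_imp_L2)
  have "(L2_norm (\<lambda>x. f x - g x))\<^sup>2 < e / 4"
    using L2_norm_add_square_le[OF L2_diff[OF f h] L2_diff[OF h gL]] 1 2 by simp
  moreover have "(L2_norm (\<lambda>x. f x - s x))\<^sup>2 \<le> 2 * (L2_norm (\<lambda>x. f x - g x))\<^sup>2 + 2 * (L2_norm (\<lambda>x. g x - s x))\<^sup>2"
    using L2_norm_add_square_le[OF L2_diff[OF f gL] L2_diff[OF gL sL]] by simp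
  ultimately have "(L2_norm (\<lambda>x. f x - s x))\<^sup>2 < e" using 3 e by simp
  with s show ?thesis by (rule that)
qed

section \<open>The Haar decomposition\<close>

lemma dyadic_average_L2: "dyadic_average n f \<in> L2"
  by (rule haar_V_imp_L2[OF dyadic_average_in_V])

lemma diff_average_in_orthocomp:
  assumes f: "f \<in> L2"
  shows "(\<lambda>x. f x - dyadic_average n f x) \<in> L2_orthocomp (haar_V n)"
proof -
  have "L2_inner (dyadic_average n f) (dyadic_step n k) = L2_inner f (dyadic_step n k)" if "k < 2 ^ n" for k
    unfolding dyadic_average_def[abs_def] using dyadic_step_comb_inner[OF that] by simp
  then show ?thesis
    unfolding orthocomp_haar_V_iff using f
    by (simp add: L2_diff dyadic_average_L2 L2_inner_diff dyadic_step_L2)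
qed

text \<open>
  The average is the best approximation from \<open>haar_V n\<close>: in
  \<open>f - g = (f - dyadic_average n f) + (dyadic_average n f - g)\<close> the second summand lies in
  \<open>haar_V n\<close> and the first is orthogonal to it.
\<close>
lemma L2_norm_diff_average_le:
  assumes f: "f \<in> L2" and g: "g \<in> haar_V n"
  shows "(L2_norm (\<lambda>x. f x - dyadic_average n f x))\<^sup>2 \<le> (L2_norm (\<lambda>x. f x - g x))\<^sup>2"
proof -
  let ?u = "\<lambda>x. f x - dyadic_average n f x" and ?v = "\<lambda>x. dyadic_average n f x - g x"
  have v: "?v \<in> haar_V n" by (intro haar_V_diff dyadic_average_in_V g)
  have "(L2_norm (\<lambda>x. ?u x + ?v x))\<^sup>2 = (L2_norm ?u)\<^sup>2 + (L2_norm ?v)\<^sup>2"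
  proof (rule L2_norm_pythagoras)
    show "L2_inner ?u ?v = 0" using diff_average_in_orthocomp[OF f] v by (simp add: L2_orthocomp_def)
  qed (intro L2_diff f dyadic_average_L2 haar_V_imp_L2[OF v])+
  then show ?thesis by simp
qed

text \<open>
  Since the spaces increase, one good approximation in \<open>haar_V m\<close> bounds the error of all
  averages of generation \<open>n \<ge> m\<close>.
\<close>
lemma dyadic_average_tendsto:
  assumes f: "f \<in> L2"
  shows "(\<lambda>n. L2_norm (\<lambda>x. f x - dyadic_average n f x)) \<longlonglongrightarrow> 0"
proof (rule LIMSEQ_I)
  fix e :: real assume e: "0 < e"
  then have "0 < e\<^sup>2" by simp
  with f obtain m s where s: "s \<in> haar_V m" and small: "(L2_norm (\<lambda>x. f x - s x))\<^sup>2 < e\<^sup>2"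
    by (rule haar_V_dense)
  have "norm (L2_norm (\<lambda>x. f x - dyadic_average n f x) - 0) < e" if "m \<le> n" for n
  proof -
    have "(L2_norm (\<lambda>x. f x - dyadic_average n f x))\<^sup>2 < e\<^sup>2"
      using L2_norm_diff_average_le[OF f subsetD[OF haar_V_mono[OF that] s]] small by linarith
    then show ?thesis using e by (simp add: L2_norm_nonneg power_less_imp_less_base)
  qed
  then show "\<exists>m. \<forall>n\<ge>m. norm (L2_norm (\<lambda>x. f x - dyadic_average n f x) - 0) < e" by blast
qed

text \<open>
  Telescoping over the levels, starting from the mean over the whole interval.
\<close>
lemma dyadic_average_eq_haar_expansion:
  assumes f: "f \<in> L2"
  shows "dyadic_average n f x = L2_inner f haar_scaling * haar_scaling x +
            (\<Sum>j<n. \<Sum>k<2 ^ j. L2_inner f (haar_wavelet j k) * haar_wavelet j k x)"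
proof (induction n)
  case 0
  then show ?case by (simp add: dyadic_average_def haar_scaling_eq_step)
next
  case (Suc n)
  then show ?case by (simp add: dyadic_average_Suc[OF f])
qed

lemma L2_plusI: "f \<in> S \<Longrightarrow> g \<in> T \<Longrightarrow> (\<lambda>x. f x + g x) \<in> L2_plus S T"
  by (auto simp: L2_plus_def)

text \<open>
  The induction step splits \<open>h \<in> haar_V (Suc n)\<close> into its average of generation \<open>n\<close> and the
  remainder, which is orthogonal to \<open>haar_V n\<close> and so lies in \<open>haar_A (Suc n)\<close>.
\<close>
lemma haar_P_eq_V: "haar_P n = haar_V n"
proof (induction n)
  case 0
  show ?case
  proof (intro equalityI subsetI)
    fix f assume "f \<in> haar_P 0"
    then obtain F c where f: "f \<in> L2" and F: "F \<subseteq> {haar_scaling}"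
      and c: "AE x in unit_lebesgue. f x = (\<Sum>g\<in>F. c g * g x)"
      unfolding haar_P.simps L2_span_def by blast
    have "(\<lambda>x. \<Sum>g\<in>F. c g * g x) \<in> haar_V 0"
      using F by (intro haar_V_sum haar_V_mult) (auto simp: haar_scaling_eq_step dyadic_step_in_V)
    with f c show "f \<in> haar_V 0" by (blast intro: haar_V_cong_AE)
  next
    fix f assume "f \<in> haar_V 0"
    then obtain c where f: "f \<in> L2" and c: "AE x in unit_lebesgue. f x = c 0 * haar_scaling x"
      unfolding haar_V_iff by (auto simp: haar_scaling_eq_step)
    then show "f \<in> haar_P 0"
      unfolding haar_P.simps L2_span_def
      by (auto intro!: exI[where x="{haar_scaling}"] exI[where x="\<lambda>_. c 0"])
  qed
next
  case (Suc n)
  show ?case unfolding haar_P.simps Suc.IH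
  proof (intro equalityI subsetI)
    fix h assume "h \<in> L2_plus (haar_V n) (haar_A (Suc n))"
    then obtain f g where "h = (\<lambda>x. f x + g x)" "f \<in> haar_V n" "g \<in> haar_A (Suc n)"
      unfolding L2_plus_def by blast
    then show "h \<in> haar_V (Suc n)"
      using haar_V_Suc[of n] by (auto simp: haar_A_Suc_iff intro!: haar_V_add)
  next
    fix h assume h: "h \<in> haar_V (Suc n)"
    let ?f = "dyadic_average n h" and ?g = "\<lambda>x. h x - dyadic_average n h x"
    have f: "?f \<in> haar_V n" by (rule dyadic_average_in_V)
    moreover have "?g \<in> haar_A (Suc n)"
      unfolding haar_A_Suc using h f haar_V_Suc[of n]
      by (auto intro!: haar_V_diff diff_average_in_orthocomp haar_V_imp_L2[OF h])
    ultimately have "(\<lambda>x. ?f x + ?g x) \<in> L2_plus (haar_V n) (haar_A (Suc n))"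
      by (rule L2_plusI)
    then show "h \<in> L2_plus (haar_V n) (haar_A (Suc n))" by simp
  qed
qed

lemma L2_self_orthogonal_AE_0:
  assumes "f \<in> L2" "L2_inner f f = 0"
  shows "AE x in unit_lebesgue. f x = 0"
  using assms by (intro L2_norm_eq_0_AE) (simp_all add: L2_inner_self)

text \<open>
  Pairing a vanishing sum with one of its terms leaves only the squared norm of that term.
\<close>
lemma L2_independent_if_orthogonal:
  assumes L2: "\<And>j. j \<in> J \<Longrightarrow> S j \<subseteq> L2"
    and orth: "\<And>i j f g. i \<in> J \<Longrightarrow> j \<in> J \<Longrightarrow> i < j \<Longrightarrow> f \<in> S i \<Longrightarrow> g \<in> S j \<Longrightarrow> L2_inner g f = 0"
  shows "L2_independent J S"
  unfolding L2_independent_def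
proof (intro allI impI ballI)
  fix F a j
  assume *: "finite F \<and> F \<subseteq> J \<and> (\<forall>j\<in>F. a j \<in> S j) \<and> (AE x in unit_lebesgue. (\<Sum>j\<in>F. a j x) = 0)"
    and j: "j \<in> F"
  then have a: "a i \<in> L2" if "i \<in> F" for i using that L2 by blast
  have "L2_inner (a i) (a j) = 0" if "i \<in> F" "i \<noteq> j" for i
  proof (cases "i < j")
    case True
    then have "L2_inner (a j) (a i) = 0" using * j that by (intro orth) auto
    then show ?thesis using L2_inner_commute[of "a i" "a j"] by simp
  next
    case False
    then have "j < i" using that by simp
    then show ?thesis using * j that by (intro orth[of j i "a j" "a i"]) auto
  qed
  then have "(\<Sum>i\<in>F. L2_inner (a i) (a j)) = (\<Sum>i\<in>F. if i = j then L2_inner (a j) (a j) else 0)"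
    by (intro sum.cong) auto
  also have "\<dots> = L2_inner (a j) (a j)" using * j by simp
  finally have "L2_inner (a j) (a j) = L2_inner (\<lambda>x. \<Sum>i\<in>F. a i x) (a j)"
    using a j by (simp add: L2_inner_sum)
  also have "\<dots> = L2_inner (\<lambda>x. 0) (a j)"
    using * a j by (intro L2_inner_cong_AE L2_sum L2_zero) auto
  finally show "AE x in unit_lebesgue. a j x = 0"
    using a j by (intro L2_self_orthogonal_AE_0) simp_all
qed

lemma haar_A_in_orthocomp_V:
  assumes "f \<in> haar_A j" "i < j"
  shows "f \<in> L2_orthocomp (haar_V i)"
proof -
  obtain n where n: "j = Suc n" "i \<le> n" using assms(2) by (cases j) auto
  then have "f \<in> L2_orthocomp (haar_V n)" using assms(1) by (simp add: haar_A_Suc)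
  then show ?thesis using haar_V_mono[OF n(2)] by (auto simp: L2_orthocomp_def)
qed

lemma haar_A_subset_V: "haar_A j \<subseteq> haar_V j"
  by (auto simp: haar_A_def)

lemma haar_independent: "L2_independent UNIV (\<lambda>j. if j = 0 then haar_P 0 else haar_A j)"
proof (rule L2_independent_if_orthogonal)
  have sub: "(if j = 0 then haar_P 0 else haar_A j) \<subseteq> haar_V j" for j
    using haar_A_subset_V by (simp add: haar_P_eq_V)
  then show "(if j = 0 then haar_P 0 else haar_A j) \<subseteq> L2" for j
    using haar_V_imp_L2 by blast
  show "L2_inner g f = 0" if ij: "i < j" and f: "f \<in> (if i = 0 then haar_P 0 else haar_A i)"
    and g: "g \<in> (if j = 0 then haar_P 0 else haar_A j)" for i j :: nat and f g
    using haar_A_in_orthocomp_V[of g j i] g ij subsetD[OF sub f] by (auto simp: L2_orthocomp_def)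
qed

lemma haar_V_Int_orthocomp_AE_0:
  assumes "f \<in> haar_V n" "f \<in> L2_orthocomp (haar_V n)"
  shows "AE x in unit_lebesgue. f x = 0"
  using assms by (intro L2_self_orthogonal_AE_0) (auto simp: L2_orthocomp_def)

lemma haar_detail_in_A: "(\<lambda>x. \<Sum>k<2 ^ j. c k * haar_wavelet j k x) \<in> haar_A (Suc j)"
  by (rule haar_A_Suc_lincomb) (simp add: haar_wavelet_in_A)

text \<open>
  The wavelets of level \<open>j\<close> belong to the summand \<open>haar_A (Suc j)\<close>, so the index is shifted by one.
\<close>
lemma haar_details_in_Sum:
  "(\<lambda>x. \<Sum>j<n. \<Sum>k<2 ^ j. c j k * haar_wavelet j k x) \<in> L2_Sum {1..} haar_A"
proof -
  let ?a = "\<lambda>j x. \<Sum>k<2 ^ (j - 1). c (j - 1) k * haar_wavelet (j - 1) k x"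
  have "(\<Sum>j<n. \<Sum>k<2 ^ j. c j k * haar_wavelet j k x) = (\<Sum>j\<in>Suc ` {..<n}. ?a j x)" for x
    by (simp add: sum.reindex)
  then show ?thesis
    unfolding L2_Sum_def
    by (auto intro!: exI[where x="Suc ` {..<n}"] exI[where x="?a"] haar_detail_in_A)
qed

lemma in_closure_of_average_details:
  assumes f: "f \<in> L2" and S: "\<And>n. dyadic_average n f \<in> S"
  shows "f \<in> L2_closure S"
  unfolding L2_closure_def
proof (intro CollectI conjI allI impI f)
  fix e :: real assume "0 < e"
  with dyadic_average_tendsto[OF f] have "\<forall>\<^sub>F n in sequentially. L2_norm (\<lambda>x. f x - dyadic_average n f x) < e"
    by (rule order_tendstoD(2))
  then obtain n where "L2_norm (\<lambda>x. f x - dyadic_average n f x) < e"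
    by (auto simp: eventually_sequentially)
  with S show "\<exists>g\<in>S. L2_norm (\<lambda>x. f x - g x) < e" by blast
qed

lemma closure_P0_plus_Sum: "L2_closure (L2_plus (haar_P 0) (L2_Sum {1..} haar_A)) = L2"
proof
  show "L2 \<subseteq> L2_closure (L2_plus (haar_P 0) (L2_Sum {1..} haar_A))"
  proof
    fix f assume f: "f \<in> L2"
    show "f \<in> L2_closure (L2_plus (haar_P 0) (L2_Sum {1..} haar_A))"
    proof (rule in_closure_of_average_details[OF f])
      fix n
      have "(\<lambda>x. L2_inner f haar_scaling * haar_scaling x) \<in> haar_P 0"
        unfolding haar_P_eq_V haar_scaling_eq_step by (intro haar_V_mult dyadic_step_in_V) simp
      then show "dyadic_average n f \<in> L2_plus (haar_P 0) (L2_Sum {1..} haar_A)"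
        unfolding dyadic_average_eq_haar_expansion[OF f, abs_def]
        using haar_details_in_Sum by (rule L2_plusI)
    qed
  qed
qed (auto simp: L2_closure_def)

text \<open>
  Let \<open>p\<close> be the projection of \<open>f\<close> onto \<open>haar_V n\<close>. If \<open>g\<close> is orthogonal to \<open>haar_V n\<close>, then
  \<open>f - g\<close> is the orthogonal sum of \<open>f - p - g\<close> and \<open>p\<close>, so \<open>L2_norm p\<close> is at most the distance of
  \<open>f\<close> and \<open>g\<close>. Hence \<open>p\<close> vanishes for \<open>f\<close> in the closure.
\<close>
lemma L2_closure_orthocomp_V:
  assumes S: "S \<subseteq> L2_orthocomp (haar_V n)"
  shows "L2_closure S \<subseteq> L2_orthocomp (haar_V n)"
proof
  fix f assume "f \<in> L2_closure S"
  then have f: "f \<in> L2" and approx: "\<And>e. 0 < e \<Longrightarrow> \<exists>g\<in>S. L2_norm (\<lambda>x. f x - g x) < e"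
    by (auto simp: L2_closure_def)
  let ?p = "dyadic_average n f"
  have "L2_norm ?p \<le> e" if e: "0 < e" for e
  proof -
    obtain g where g: "g \<in> S" and less: "L2_norm (\<lambda>x. f x - g x) < e" using approx[OF e] by blast
    have go: "g \<in> L2_orthocomp (haar_V n)" using g S by blast
    then have gL: "g \<in> L2" by (simp add: L2_orthocomp_def)
    let ?r = "\<lambda>x. (f x - ?p x) - g x"
    have r: "?r \<in> L2" by (intro L2_diff f gL dyadic_average_L2)
    have "L2_inner ?r ?p = 0"
      using diff_average_in_orthocomp[OF f, of n] go dyadic_average_in_V[of n f]
      by (subst L2_inner_diff) (auto simp: L2_orthocomp_def dyadic_average_L2)
    then have "(L2_norm (\<lambda>x. ?r x + ?p x))\<^sup>2 = (L2_norm ?r)\<^sup>2 + (L2_norm ?p)\<^sup>2"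
      by (intro L2_norm_pythagoras r dyadic_average_L2)
    then have "(L2_norm ?p)\<^sup>2 \<le> (L2_norm (\<lambda>x. f x - g x))\<^sup>2" by simp
    then have "L2_norm ?p \<le> L2_norm (\<lambda>x. f x - g x)"
      by (rule power2_le_imp_le) (rule L2_norm_nonneg)
    with less show ?thesis by simp
  qed
  then have "L2_norm ?p \<le> 0" by (rule field_le_epsilon[of _ 0, simplified])
  then have "AE x in unit_lebesgue. ?p x = 0"
    using L2_norm_nonneg[of ?p] by (intro L2_norm_eq_0_AE dyadic_average_L2) simp
  then have "L2_inner ?p g = 0" if "g \<in> L2" for g
    using L2_inner_cong_AE[OF dyadic_average_L2 L2_zero that] by simp
  moreover have "L2_inner (\<lambda>x. f x - ?p x) g = 0" if "g \<in> haar_V n" for g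
    using diff_average_in_orthocomp[OF f, of n] that by (simp add: L2_orthocomp_def)
  ultimately have "L2_inner f g = 0" if "g \<in> haar_V n" for g
    using L2_inner_diff[OF f dyadic_average_L2[of n f] haar_V_imp_L2[OF that]] haar_V_imp_L2[OF that] that
    by simp
  with f show "f \<in> L2_orthocomp (haar_V n)" by (simp add: L2_orthocomp_def)
qed

lemma closure_Sum_A: "L2_closure (L2_Sum {1..} haar_A) = L2_orthocomp (haar_P 0)"
  unfolding haar_P_eq_V
proof
  show "L2_closure (L2_Sum {1..} haar_A) \<subseteq> L2_orthocomp (haar_V 0)"
  proof (rule L2_closure_orthocomp_V, rule subsetI)
    fix f assume "f \<in> L2_Sum {1..} haar_A"
    then obtain F a where F: "F \<subseteq> {1..}" "\<And>j. j \<in> F \<Longrightarrow> a j \<in> haar_A j" and f: "f = (\<lambda>x. \<Sum>j\<in>F. a j x)"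
      unfolding L2_Sum_def by blast
    have "a j \<in> L2_orthocomp (haar_V 0)" if "j \<in> F" for j
      using F that by (intro haar_A_in_orthocomp_V[of _ j]) auto
    then show "f \<in> L2_orthocomp (haar_V 0)"
      unfolding f orthocomp_haar_V_iff by (auto simp: L2_inner_sum L2_sum dyadic_step_L2)
  qed
  show "L2_orthocomp (haar_V 0) \<subseteq> L2_closure (L2_Sum {1..} haar_A)"
  proof
    fix f assume "f \<in> L2_orthocomp (haar_V 0)"
    then have f: "f \<in> L2" and "L2_inner f haar_scaling = 0"
      unfolding orthocomp_haar_V_iff haar_scaling_eq_step by auto
    then have "dyadic_average n f = (\<lambda>x. \<Sum>j<n. \<Sum>k<2 ^ j. L2_inner f (haar_wavelet j k) * haar_wavelet j k x)" for n
      by (intro ext) (simp add: dyadic_average_eq_haar_expansion)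
    then have "dyadic_average n f \<in> L2_Sum {1..} haar_A" for n
      using haar_details_in_Sum by simp
    with f show "f \<in> L2_closure (L2_Sum {1..} haar_A)" by (rule in_closure_of_average_details)
  qed
qed

theorem theorem2p34:
  shows
    "(\<forall>j\<ge>1. haar_A j = L2_span {haar_wavelet (j - 1) k |k. k < 2 ^ (j - 1)}
        \<and> haar_A j = haar_V j \<inter> L2_orthocomp (haar_V (j - 1)))
   \<and> (\<forall>j\<ge>1. \<forall>f \<in> haar_P (j - 1) \<inter> haar_A j. AE x in unit_lebesgue. f x = 0)
   \<and> L2_independent UNIV (\<lambda>j. if j = 0 then haar_P 0 else haar_A j)
   \<and> L2_closure (L2_plus (haar_P 0) (L2_Sum {1..} haar_A)) = L2
   \<and> L2_closure (L2_Sum {1..} haar_A) = L2_orthocomp (haar_P 0)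
   \<and> (\<forall>j. haar_P j = haar_V j)
   \<and> (\<forall>f\<in>L2. (\<lambda>n. L2_norm (\<lambda>x. f x -
           (L2_inner f haar_scaling * haar_scaling x +
            (\<Sum>j<n. \<Sum>k<2 ^ j. L2_inner f (haar_wavelet j k) * haar_wavelet j k x))))
         \<longlonglongrightarrow> 0)"
proof (intro conjI allI impI ballI)
  fix j :: nat assume "1 \<le> j"
  then obtain n where j: "j = Suc n" by (cases j) auto
  show "haar_A j = L2_span {haar_wavelet (j - 1) k |k. k < 2 ^ (j - 1)}"
    unfolding j diff_Suc_1 by (rule haar_A_Suc_eq_span)
  show "haar_A j = haar_V j \<inter> L2_orthocomp (haar_V (j - 1))"
    unfolding j diff_Suc_1 by (rule haar_A_Suc)
  fix f assume "f \<in> haar_P (j - 1) \<inter> haar_A j"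
  then show "AE x in unit_lebesgue. f x = 0"
    by (intro haar_V_Int_orthocomp_AE_0[of _ n]) (auto simp: j haar_P_eq_V haar_A_Suc)
next
  fix f assume f: "f \<in> L2"
  show "(\<lambda>n. L2_norm (\<lambda>x. f x -
           (L2_inner f haar_scaling * haar_scaling x +
            (\<Sum>j<n. \<Sum>k<2 ^ j. L2_inner f (haar_wavelet j k) * haar_wavelet j k x))))
         \<longlonglongrightarrow> 0"
    using dyadic_average_tendsto[OF f] unfolding dyadic_average_eq_haar_expansion[OF f] .
qed (rule haar_independent closure_P0_plus_Sum closure_Sum_A haar_P_eq_V)+

end
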